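(* Let $k$ be an admissible kernel, let $\varphi\colon(0,\infty)\to(0,\infty)$ be a nondecreasing function and let $C\in(0,\infty)$. Define $w(t):=\|k(\cdot,t)\|_{L^1}$, $t\in(0,\infty)$. Then the following statements are equivalent: (i) $w^*(t)\le \frac{C}{\varphi(t)}$ for a.e. $t\in(0,\infty)$, and $\|k(\cdot,t)\|_{L^\infty}\le C$ for a.e. $t\in(0,\infty)$; (ii) $K_k\colon L^\infty\to m_\varphi$, $K_k\colon L^1\to L^\infty$, $\|K_k\|_{L^\infty\to m_\varphi}\le C$, and $\|K_k\|_{L^1\to L^\infty}\le C$; (iii) for every $f\in L^1+L^\infty$, $(K_kf)^*(t)\le C\int_0^{1/\varphi(t)}f^*(s)\,ds$ for a.e. $t\in(0,\infty)$.
   Context: All function spaces are over $(0,\infty)$ with Lebesgue measure $\lambda$, $L^p=L^p(0,\infty)$; $\mathcal M(0,\infty)$ denotes the set of measurable $f\colon(0,\infty)\to[-\infty,\infty]$. Convention: $0\cdot\infty=0$. The nonincreasing rearrangement of $f\in\mathcal M(0,\infty)$ is $f^*(x):=\inf\{t\in[0,\infty):\lambda(\{y\in(0,\infty):|f(y)|>t\})\le x\}$, $x\in[0,\infty)$. For a nondecreasing $\varphi\colon(0,\infty)\to(0,\infty)$ put $\|f\|_{m_\varphi}:=\operatorname{ess\,sup}_{t\in(0,\infty)}\varphi(t)f^*(t)$ and $m_\varphi:=\{f\in\mathcal M(0,\infty):\|f\|_{m_\varphi}<\infty\}$ (this need not be a linear space, nor $\|\cdot\|_{m_\varphi}$ a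 quasinorm). An admissible kernel is a measurable function $k\colon(0,\infty)\times(0,\infty)\to[0,\infty]$ such that $k(\cdot,t)$ is integrable on $(0,\infty)$ for a.e. $t\in(0,\infty)$. The associated operator is $K_kf(t):=\int_0^\infty f(s)k(s,t)\,ds$, $t\in(0,\infty)$, for every $f\in\mathcal M(0,\infty)$ for which the integral makes sense. $T\colon X\to Y$ means that $T$ is bounded from $X$ to $Y$, i.e. $\|T\|_{X\to Y}:=\sup\{\|Tf\|_Y: f\in X,\ \|f\|_X\le1\}<\infty$. *)

theory Defs
  imports "HOL-Probability.Essential_Supremum"
begin

text \<open>Functions on \<open>(0,\<infinity>)\<close> are represented by functions on \<^typ>\<open>real\<close>; their values outside
  \<open>(0,\<infinity>)\<close> never matter. Measurability is Lebesgue measurability. On \<^typ>\<open>ereal\<close> and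
  \<^typ>\<open>ennreal\<close> multiplication satisfies \<open>0 * \<infinity> = 0\<close>.\<close>

abbreviation lam :: "real measure" where
  "lam \<equiv> lebesgue_on {0<..}"

abbreviation meas_fun :: "(real \<Rightarrow> ereal) set" where
  "meas_fun \<equiv> borel_measurable lam"

text \<open>The infimum of the empty set is \<open>\<infinity>\<close>.\<close>

definition rearr :: "(real \<Rightarrow> ereal) \<Rightarrow> real \<Rightarrow> ennreal" where
  "rearr f x = Inf {ennreal t | t. 0 \<le> t \<and>
     emeasure lam {y \<in> {0<..}. ereal t < \<bar>f y\<bar>} \<le> ennreal x}"

definition L1_norm :: "(real \<Rightarrow> ereal) \<Rightarrow> ennreal" where
  "L1_norm f = (\<integral>\<^sup>+ x. e2ennreal \<bar>f x\<bar> \<partial>lam)"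

text \<open>\<^const>\<open>esssup\<close> of a non-measurable function is \<open>\<infinity>\<close>.\<close>

definition Linf_norm :: "(real \<Rightarrow> ereal) \<Rightarrow> ennreal" where
  "Linf_norm f = esssup lam (\<lambda>x. e2ennreal \<bar>f x\<bar>)"

definition m_norm :: "(real \<Rightarrow> real) \<Rightarrow> (real \<Rightarrow> ereal) \<Rightarrow> ennreal" where
  "m_norm \<phi> f = esssup lam (\<lambda>t. ennreal (\<phi> t) * rearr f t)"

text \<open>The space determined by a functional \<open>N\<close>; this gives \<open>L\<^sup>1\<close>, \<open>L\<^sup>\<infinity>\<close> and \<open>m\<^sub>\<phi>\<close>.\<close>

definition fspace :: "((real \<Rightarrow> ereal) \<Rightarrow> ennreal) \<Rightarrow> (real \<Rightarrow> ereal) set" where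
  "fspace N = {f \<in> meas_fun. N f < \<infinity>}"

text \<open>Summands in \<open>L\<^sup>1\<close> and \<open>L\<^sup>\<infinity>\<close> are finite almost everywhere, so the sum is meaningful
  almost everywhere.\<close>

definition L1_plus_Linf :: "(real \<Rightarrow> ereal) set" where
  "L1_plus_Linf = {f \<in> meas_fun. \<exists>g \<in> fspace L1_norm. \<exists>h \<in> fspace Linf_norm.
     AE x in lam. f x = g x + h x}"

text \<open>The Lebesgue integral of an extended real valued function. It makes sense, with a value
  in \<open>[-\<infinity>,\<infinity>]\<close>, unless the positive and the negative part both have infinite integral.
  Note that \<^const>\<open>e2ennreal\<close> maps negative numbers to \<open>0\<close>.\<close>

definition has_ext_integral :: "(real \<Rightarrow> ereal) \<Rightarrow> bool" where
  "has_ext_integral g \<longleftrightarrow> g \<in> meas_fun \<and>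
     ((\<integral>\<^sup>+ s. e2ennreal (g s) \<partial>lam) < \<infinity> \<or> (\<integral>\<^sup>+ s. e2ennreal (- g s) \<partial>lam) < \<infinity>)"

definition ext_integral :: "(real \<Rightarrow> ereal) \<Rightarrow> ereal" where
  "ext_integral g =
     enn2ereal (\<integral>\<^sup>+ s. e2ennreal (g s) \<partial>lam) - enn2ereal (\<integral>\<^sup>+ s. e2ennreal (- g s) \<partial>lam)"

definition admissible_kernel :: "(real \<Rightarrow> real \<Rightarrow> ennreal) \<Rightarrow> bool" where
  "admissible_kernel k \<longleftrightarrow>
     (\<lambda>(s, t). k s t) \<in> borel_measurable (lebesgue_on ({0<..} \<times> {0<..})) \<and>
     (AE t in lam. (\<lambda>s. k s t) \<in> borel_measurable lam \<and> (\<integral>\<^sup>+ s. k s t \<partial>lam) < \<infinity>)"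

text \<open>The operator is partial: its domain consists of the \<open>f\<close> for which the defining integral
  makes sense for almost every \<open>t\<close>.\<close>

definition kernel_dom :: "(real \<Rightarrow> real \<Rightarrow> ennreal) \<Rightarrow> (real \<Rightarrow> ereal) set" where
  "kernel_dom k = {f \<in> meas_fun. AE t in lam. has_ext_integral (\<lambda>s. f s * enn2ereal (k s t))}"

definition kernel_op :: "(real \<Rightarrow> real \<Rightarrow> ennreal) \<Rightarrow> (real \<Rightarrow> ereal) \<Rightarrow> real \<Rightarrow> ereal" where
  "kernel_op k f t = ext_integral (\<lambda>s. f s * enn2ereal (k s t))"

text \<open>\<open>N\<close> and \<open>N'\<close> are the functionals of the source and the target space.\<close>

definition op_norm :: "((real \<Rightarrow> ereal) \<Rightarrow> ennreal) \<Rightarrow> ((real \<Rightarrow> ereal) \<Rightarrow> ennreal) \<Rightarrow>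
    ((real \<Rightarrow> ereal) \<Rightarrow> real \<Rightarrow> ereal) \<Rightarrow> ennreal" where
  "op_norm N N' T = (SUP f \<in> {f \<in> fspace N. N f \<le> 1}. N' (T f))"

text \<open>\<open>T\<close>, a partial operator with domain \<open>D\<close>, is defined on the whole source space, maps it into
  the target space and is bounded.\<close>

definition bounded_op :: "(real \<Rightarrow> ereal) set \<Rightarrow> ((real \<Rightarrow> ereal) \<Rightarrow> real \<Rightarrow> ereal) \<Rightarrow>
    ((real \<Rightarrow> ereal) \<Rightarrow> ennreal) \<Rightarrow> ((real \<Rightarrow> ereal) \<Rightarrow> ennreal) \<Rightarrow> bool" where
  "bounded_op D T N N' \<longleftrightarrow>
     fspace N \<subseteq> D \<and> T ` fspace N \<subseteq> fspace N' \<and> op_norm N N' T < \<infinity>"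

end

theory Submission
  imports Defs
begin

text \<open>The implications are shown in the order (i), (iii), (ii), (i). Given (i), put \<open>a = 1/\<phi>(x)\<close> and
  cut \<open>|f|\<close> at the level \<open>c = f\<^sup>*(a)\<close>: since \<open>|f| \<le> (|f| - c)\<^sup>+ + c\<close>, one has
  \<open>|K f| \<le> C \<parallel>(|f| - c)\<^sup>+\<parallel>\<^sub>1 + c w\<close> almost everywhere, and \<open>w\<^sup>*(x) \<le> C a\<close> yields
  \<open>(K f)\<^sup>*(x) \<le> C (\<parallel>(|f| - c)\<^sup>+\<parallel>\<^sub>1 + c a) = C \<integral>\<^sub>0\<^sup>a f\<^sup>*\<close> by the layer cake formula. From (iii),
  (ii) follows because that integral is at most \<open>\<parallel>f\<parallel>\<^sub>1\<close> and at most \<open>a \<parallel>f\<parallel>\<^sub>\<infinity>\<close>. Finally \<open>K 1 = w\<close>, and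
  testing (ii) on normalised indicators of rational intervals gives, for almost every \<open>t\<close>,
  \<open>\<integral>\<^sub>I k(s,t) ds \<le> C |I|\<close> for all these intervals at once, whence \<open>k(\<cdot>,t) \<le> C\<close> by Vitali's covering
  theorem.\<close>

section \<open>Distribution functions and rearrangements\<close>

definition distribution :: "(real \<Rightarrow> ereal) \<Rightarrow> real \<Rightarrow> ennreal" where
  "distribution f s = emeasure lam {y \<in> {0<..}. ereal s < \<bar>f y\<bar>}"

lemma ereal_less_abs_iff: "0 \<le> s \<Longrightarrow> ereal s < \<bar>x\<bar> \<longleftrightarrow> ennreal s < e2ennreal \<bar>x\<bar>"
  by (cases x) (auto simp: ennreal_less_iff)

lemma level_set_measurable [measurable]:
  assumes [measurable]: "f \<in> meas_fun"
  shows "{y \<in> {0<..}. ereal s < \<bar>f y\<bar>} \<in> sets lam"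
proof -
  have "{y \<in> space lam. ereal s < \<bar>f y\<bar>} \<in> sets lam" by measurable
  then show ?thesis by simp
qed

lemma distribution_antimono:
  assumes "f \<in> meas_fun" "s \<le> t"
  shows "distribution f t \<le> distribution f s"
proof -
  have "ereal s < \<bar>f y\<bar>" if "ereal t < \<bar>f y\<bar>" for y
    using assms(2) that by (metis ereal_less_eq(3) le_less_trans)
  then show ?thesis
    unfolding distribution_def using assms(1) by (intro emeasure_mono level_set_measurable) auto
qed

text \<open>The distribution function is right-continuous, so the infimum defining
  \<open>rearr f x\<close> is attained whenever it is finite. Thus \<open>rearr f\<close> and
  \<open>distribution f\<close> are generalised inverses with strict inequalities; levels of the
  rearrangement are computed below through this equivalence.\<close>

lemma less_rearr_iff:
  assumes f: "f \<in> meas_fun" and s: "0 \<le> s"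
  shows "ennreal s < rearr f x \<longleftrightarrow> ennreal x < distribution f s"
proof
  assume "ennreal s < rearr f x"
  show "ennreal x < distribution f s"
  proof (rule ccontr)
    assume "\<not> ennreal x < distribution f s"
    then have "rearr f x \<le> ennreal s"
      unfolding rearr_def distribution_def using s by (intro Inf_lower) auto
    with \<open>ennreal s < rearr f x\<close> show False by simp
  qed
next
  assume less: "ennreal x < distribution f s"
  show "ennreal s < rearr f x"
  proof (rule ccontr)
    assume "\<not> ennreal s < rearr f x"
    then have le: "rearr f x \<le> ennreal s" by simp
    have small: "distribution f t \<le> ennreal x" if "s < t" for t
    proof -
      have "rearr f x < ennreal t"
        using le that s by (meson ennreal_lessI le_less_trans)
      then obtain r where r: "0 \<le> r" "ennreal r < ennreal t" "distribution f r \<le> ennreal x"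
        unfolding rearr_def distribution_def Inf_less_iff by auto
      then show ?thesis
        using distribution_antimono[OF f, of r t] by (meson ennreal_leI leD linorder_le_cases order_trans)
    qed
    \<comment> \<open>The levels \<open>s + 1/(n+1)\<close> lie strictly above \<open>s\<close>, so
      \<open>small\<close> applies to each of them, and their superlevel sets increase to the one at
      \<open>s\<close>. Continuity from below carries the bound over to \<open>s\<close>
      itself.\<close>
    let ?A = "\<lambda>n. {y \<in> {0<..}. ereal (s + 1 / real (Suc n)) < \<bar>f y\<bar>}"
    have eq: "{y \<in> {0<..}. ereal s < \<bar>f y\<bar>} = (\<Union>n. ?A n)"
    proof (intro set_eqI iffI)
      fix y assume y: "y \<in> {y \<in> {0<..}. ereal s < \<bar>f y\<bar>}"
      then obtain r where r: "ereal s < ereal r" "ereal r < \<bar>f y\<bar>"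
        using ereal_dense2[of "ereal s" "\<bar>f y\<bar>"] by auto
      then obtain n where "1 / real (Suc n) < r - s"
        using nat_approx_posE[of "r - s"] by auto
      then have "ereal (s + 1 / real (Suc n)) < \<bar>f y\<bar>"
        using r by (intro less_trans[OF _ r(2)]) simp
      with y show "y \<in> (\<Union>n. ?A n)" by blast
    next
      fix y assume "y \<in> (\<Union>n. ?A n)"
      then obtain n where n: "0 < y" "ereal (s + 1 / real (Suc n)) < \<bar>f y\<bar>" by auto
      have "ereal s \<le> ereal (s + 1 / real (Suc n))" by simp
      with n show "y \<in> {y \<in> {0<..}. ereal s < \<bar>f y\<bar>}"
        using le_less_trans by blast
    qed
    have "incseq ?A"
    proof (intro incseq_SucI subsetI)
      fix n y assume "y \<in> ?A n"
      moreover have "ereal (s + 1 / real (Suc (Suc n))) \<le> ereal (s + 1 / real (Suc n))"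
        by (simp add: frac_le)
      ultimately show "y \<in> ?A (Suc n)" using le_less_trans by blast
    qed
    then have "distribution f s = (SUP n. distribution f (s + 1 / real (Suc n)))"
      unfolding distribution_def eq
      by (subst SUP_emeasure_incseq) (use level_set_measurable[OF f] in auto)
    also have "\<dots> \<le> ennreal x"
      by (intro SUP_least small) simp
    finally show False using less by simp
  qed
qed

lemma rearr_le_iff:
  "f \<in> meas_fun \<Longrightarrow> 0 \<le> s \<Longrightarrow> rearr f x \<le> ennreal s \<longleftrightarrow> distribution f s \<le> ennreal x"
  by (simp add: less_rearr_iff not_less[symmetric] del: not_less)

lemma rearr_antimono:
  assumes "x \<le> y"
  shows "rearr f y \<le> rearr f x"
  unfolding rearr_def
  by (intro Inf_superset_mono) (auto intro: order_trans[OF _ ennreal_leI[OF assms]])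

text \<open>A superlevel set contains with each point all smaller ones. It is therefore empty, the
  whole line, or a half-line ending at its supremum, which may or may not belong to it.\<close>

lemma borel_measurable_antimono_ennreal:
  fixes g :: "real \<Rightarrow> ennreal"
  assumes "\<And>x y. x \<le> y \<Longrightarrow> g y \<le> g x"
  shows "g \<in> borel_measurable borel"
proof (rule borel_measurableI_greater)
  fix c
  let ?D = "{x. c < g x}"
  have down: "x \<in> ?D" if "y \<in> ?D" "x \<le> y" for x y
    using assms[OF that(2)] that(1) by auto
  have "?D \<in> sets borel"
  proof (cases "?D = {} \<or> \<not> bdd_above ?D")
    case True
    then consider "?D = {}" | "\<And>x. \<exists>y\<in>?D. x \<le> y"
      unfolding bdd_above_def by (metis linorder_le_cases)
    then show ?thesis
    proof cases
      case 2
      then have "x \<in> ?D" for x using down by meson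
      then have "?D = UNIV" by blast
      then show ?thesis by simp
    qed (simp only: sets.empty_sets)
  next
    case False
    define S where "S = Sup ?D"
    have le: "x \<le> S" if "x \<in> ?D" for x
      unfolding S_def using that False by (intro cSup_upper) auto
    have less: "x \<in> ?D" if "x < S" for x
    proof -
      have "\<exists>y\<in>?D. x < y"
        using that False unfolding S_def by (subst less_cSup_iff[symmetric]) auto
      then show ?thesis using down by (meson less_imp_le)
    qed
    show ?thesis
    proof (cases "S \<in> ?D")
      case True
      then have "x \<in> ?D \<longleftrightarrow> x \<le> S" for x using le down by blast
      then have "?D = {..S}" by blast
      then show ?thesis by (simp only: atMost_borel)
    next
      case False
      then have "x \<in> ?D \<longleftrightarrow> x < S" for x using le less by (metis order_le_less)
      then have "?D = {..<S}" by blast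
      then show ?thesis by (simp only: lessThan_borel)
    qed
  qed
  then show "{x \<in> space borel. c < g x} \<in> sets borel"
    by simp
qed

lemma rearr_measurable: "rearr f \<in> borel_measurable borel"
  by (rule borel_measurable_antimono_ennreal) (rule rearr_antimono)

section \<open>Layer cake formula and integrals of the rearrangement\<close>

lemma emeasure_lborel_below_ennreal:
  "emeasure lborel {s. 0 \<le> s \<and> ennreal s < c} = c"
proof (cases c)
  case (real r)
  then have "{s. 0 \<le> s \<and> ennreal s < c} = {0..<r}"
    by (auto simp: ennreal_less_iff)
  then show ?thesis using real by simp
next
  case top
  then have "{s. 0 \<le> s \<and> ennreal s < c} = {0..}" by auto
  moreover have "emeasure lborel {0::real..} = \<infinity>"
  proof (rule ccontr)
    assume "emeasure lborel {0::real..} \<noteq> \<infinity>"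
    then obtain r where r: "0 \<le> r" "emeasure lborel {0::real..} = ennreal r"
      by (cases "emeasure lborel {0::real..}") auto
    have "emeasure lborel {0..r + 1} \<le> emeasure lborel {0::real..}"
      by (intro emeasure_mono) auto
    with r show False by (simp add: ennreal_le_iff)
  qed
  ultimately show ?thesis using top by simp
qed

text \<open>Tonelli's theorem on the region 0 \<le> s < g(y). The factor
  \<open>indicator {0..} s\<close> matters: \<open>ennreal s\<close> is 0 for negative
  \<open>s\<close>, so without it those levels would contribute as well.\<close>

lemma nn_integral_layer_cake:
  assumes "sigma_finite_measure M" and [measurable]: "g \<in> borel_measurable M"
  shows "(\<integral>\<^sup>+ y. g y \<partial>M) =
    (\<integral>\<^sup>+ s. indicator {0..} s * emeasure M {y \<in> space M. ennreal s < g y} \<partial>lborel)"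
proof -
  interpret sigma_finite_measure M by fact
  interpret pair_sigma_finite M lborel ..
  let ?h = "\<lambda>y s. indicator {s. 0 \<le> s \<and> ennreal s < g y} s :: ennreal"
  have "(\<integral>\<^sup>+ y. g y \<partial>M) = (\<integral>\<^sup>+ y. (\<integral>\<^sup>+ s. ?h y s \<partial>lborel) \<partial>M)"
    by (subst nn_integral_indicator) (auto simp: emeasure_lborel_below_ennreal)
  also have "\<dots> = (\<integral>\<^sup>+ s. (\<integral>\<^sup>+ y. ?h y s \<partial>M) \<partial>lborel)"
    by (rule Fubini'[symmetric]) (simp add: indicator_def, measurable)
  also have "\<dots> = (\<integral>\<^sup>+ s. indicator {0..} s * emeasure M {y \<in> space M. ennreal s < g y} \<partial>lborel)"
  proof (intro nn_integral_cong)
    fix s :: real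
    have "(\<integral>\<^sup>+ y. ?h y s \<partial>M) = (\<integral>\<^sup>+ y. indicator {0..} s * indicator {y \<in> space M. ennreal s < g y} y \<partial>M)"
      by (intro nn_integral_cong) (auto simp: indicator_def)
    then show "(\<integral>\<^sup>+ y. ?h y s \<partial>M) = indicator {0..} s * emeasure M {y \<in> space M. ennreal s < g y}"
      by (simp add: nn_integral_cmult_indicator)
  qed
  finally show ?thesis .
qed

lemma sigma_finite_lebesgue: "sigma_finite_measure (lebesgue :: real measure)"
proof
  obtain A :: "real set set" where "countable A" "A \<subseteq> sets lborel" "\<Union>A = space lborel" "\<forall>a\<in>A. emeasure lborel a \<noteq> \<infinity>"
    using lborel.sigma_finite_countable by auto
  then show "\<exists>A::real set set. countable A \<and> A \<subseteq> sets lebesgue \<and> \<Union>A = space lebesgue \<and>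
      (\<forall>a\<in>A. emeasure lebesgue a \<noteq> \<infinity>)"
    by (intro exI[of _ A]) auto
qed

lemma sigma_finite_lebesgue_on:
  "S \<in> sets lebesgue \<Longrightarrow> sigma_finite_measure (lebesgue_on S :: real measure)"
  by (rule sigma_finite_measure_restrict_space[OF sigma_finite_lebesgue])

lemma rearr_measurable_on [measurable]: "rearr f \<in> borel_measurable (lebesgue_on S)"
  using rearr_measurable by (simp add: measurable_completion measurable_restrict_space1)

text \<open>By \<open>less_rearr_iff\<close> the set is the open interval from 0 to the smaller of
  \<open>a\<close> and \<open>distribution f s\<close>.\<close>

lemma emeasure_rearr_greater:
  assumes "f \<in> meas_fun" "0 \<le> s" "0 \<le> a"
  shows "emeasure (lebesgue_on {0<..<a}) {y. 0 < y \<and> y < a \<and> ennreal s < rearr f y} = min (ennreal a) (distribution f s)"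
proof -
  have "{y. 0 < y \<and> y < a \<and> ennreal s < rearr f y} = {y \<in> {0<..<a}. ennreal y < distribution f s}"
    using assms by (auto simp: less_rearr_iff)
  also have "emeasure (lebesgue_on {0<..<a}) \<dots> = min (ennreal a) (distribution f s)"
  proof (cases "distribution f s")
    case (real r)
    then have eq: "{y \<in> {0<..<a}. ennreal y < distribution f s} = {0<..<min a r}"
      by (auto simp: ennreal_less_iff)
    have "emeasure (lebesgue_on {0<..<a}) {0<..<min a r} = emeasure lebesgue {0<..<min a r}"
      by (rule emeasure_restrict_space) auto
    also have "\<dots> = ennreal (min a r)"
      using real assms by simp
    also have "\<dots> = min (ennreal a) (ennreal r)"
      using real assms by (simp add: min_def ennreal_le_iff)
    finally show ?thesis
      unfolding eq unfolding real(2) .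
  next
    case top
    have "ennreal y < distribution f s" for y
      unfolding top by (rule ennreal_less_top)
    then have eq: "{y \<in> {0<..<a}. ennreal y < distribution f s} = {0<..<a}"
      by blast
    have "emeasure (lebesgue_on {0<..<a}) {0<..<a} = emeasure lebesgue {0<..<a}"
      by (rule emeasure_restrict_space) auto
    also have "\<dots> = ennreal a"
      using assms by simp
    finally show ?thesis
      unfolding eq unfolding top by simp
  qed
  finally show ?thesis .
qed

lemma nn_integral_rearr_eq:
  assumes "f \<in> meas_fun" "0 \<le> a"
  shows "(\<integral>\<^sup>+ y. rearr f y \<partial>lebesgue_on {0<..<a}) =
    (\<integral>\<^sup>+ s. indicator {0..} s * min (ennreal a) (distribution f s) \<partial>lborel)"
proof -
  have "(\<integral>\<^sup>+ y. rearr f y \<partial>lebesgue_on {0<..<a}) = (\<integral>\<^sup>+ s. indicator {0..} s *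
      emeasure (lebesgue_on {0<..<a}) {y \<in> space (lebesgue_on {0<..<a}). ennreal s < rearr f y} \<partial>lborel)"
    by (intro nn_integral_layer_cake sigma_finite_lebesgue_on) auto
  also have "\<dots> = (\<integral>\<^sup>+ s. indicator {0..} s * min (ennreal a) (distribution f s) \<partial>lborel)"
  proof (intro nn_integral_cong)
    fix s
    show "indicator {0..} s * emeasure (lebesgue_on {0<..<a}) {y \<in> space (lebesgue_on {0<..<a}). ennreal s < rearr f y} =
      indicator {0..} s * min (ennreal a) (distribution f s)"
      using assms by (cases "0 \<le> s") (simp_all add: emeasure_rearr_greater)
  qed
  finally show ?thesis .
qed

text \<open>Both sides are integrals over levels: on the left the integrand is the minimum of
  \<open>a\<close> and \<open>distribution f s\<close>, on the right it is
  \<open>distribution f s\<close> itself.\<close>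

lemma nn_integral_rearr_le_L1_norm:
  assumes f [measurable]: "f \<in> meas_fun" and "0 \<le> a"
  shows "(\<integral>\<^sup>+ y. rearr f y \<partial>lebesgue_on {0<..<a}) \<le> L1_norm f"
proof -
  have "L1_norm f = (\<integral>\<^sup>+ s. indicator {0..} s * distribution f s \<partial>lborel)"
    unfolding L1_norm_def
    by (subst nn_integral_layer_cake[OF sigma_finite_lebesgue_on])
      (auto intro!: nn_integral_cong simp: indicator_def distribution_def ereal_less_abs_iff)
  then show ?thesis
    using assms by (auto simp: nn_integral_rearr_eq intro!: nn_integral_mono mult_left_mono)
qed

text \<open>At the level \<open>c = f\<^sup>*(a)\<close> one has \<open>|{|f| > c + s}| \<le> a\<close> for all \<open>s \<ge> 0\<close>, so that \<open>(|f| - c)\<^sup>+\<close>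
  and the restriction of \<open>f\<^sup>* - c\<close> to \<open>(0,a)\<close> are equimeasurable.\<close>

lemma nn_integral_truncation_le_rearr:
  assumes f [measurable]: "f \<in> meas_fun" and "0 \<le> a" "0 \<le> c" and c: "rearr f a = ennreal c"
  shows "(\<integral>\<^sup>+ y. (e2ennreal \<bar>f y\<bar> - ennreal c) \<partial>lam) + ennreal c * ennreal a
    \<le> (\<integral>\<^sup>+ y. rearr f y \<partial>lebesgue_on {0<..<a})"
proof -
  \<comment> \<open>Subtraction on \<open>ennreal\<close> is truncated at 0 and thus gives the
    positive part. Levels of the truncation are levels of \<open>u\<close> shifted by
    \<open>c\<close>.\<close>
  have less_diff: "ennreal s < u - ennreal c \<longleftrightarrow> ennreal (s + c) < u" if "0 \<le> s" for s u
    using that \<open>0 \<le> c\<close>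
    by (cases u) (auto simp: ennreal_minus ennreal_less_iff simp flip: ennreal_plus)
  have small: "distribution f (s + c) \<le> ennreal a" if "0 \<le> s" for s
    using that \<open>0 \<le> c\<close> rearr_le_iff[OF f, of c a] distribution_antimono[OF f, of c "s + c"] c by auto
  have "(\<integral>\<^sup>+ y. (e2ennreal \<bar>f y\<bar> - ennreal c) \<partial>lam) =
      (\<integral>\<^sup>+ s. indicator {0..} s * distribution f (s + c) \<partial>lborel)"
    using \<open>0 \<le> c\<close>
    by (subst nn_integral_layer_cake[OF sigma_finite_lebesgue_on])
      (auto intro!: nn_integral_cong simp: less_diff indicator_def distribution_def ereal_less_abs_iff simp del: ennreal_plus)
  also have "\<dots> = (\<integral>\<^sup>+ y. (rearr f y - ennreal c) \<partial>lebesgue_on {0<..<a})"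
    using assms small
    by (subst nn_integral_layer_cake[OF sigma_finite_lebesgue_on])
      (auto intro!: nn_integral_cong simp: less_diff indicator_def emeasure_rearr_greater min_absorb2 simp del: ennreal_plus)
  finally have "(\<integral>\<^sup>+ y. (e2ennreal \<bar>f y\<bar> - ennreal c) \<partial>lam) + ennreal c * ennreal a =
      (\<integral>\<^sup>+ y. (rearr f y - ennreal c) \<partial>lebesgue_on {0<..<a}) + (\<integral>\<^sup>+ y. ennreal c \<partial>lebesgue_on {0<..<a})"
    using \<open>0 \<le> a\<close> by (simp add: emeasure_restrict_space)
  also have "\<dots> = (\<integral>\<^sup>+ y. (rearr f y - ennreal c) + ennreal c \<partial>lebesgue_on {0<..<a})"
    by (intro nn_integral_add[symmetric]) auto
  \<comment> \<open>For \<open>y < a\<close> monotonicity gives \<open>c \<le> rearr f y\<close>, so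
    the truncated subtraction can be undone.\<close>
  also have "\<dots> = (\<integral>\<^sup>+ y. rearr f y \<partial>lebesgue_on {0<..<a})"
  proof (intro nn_integral_cong)
    fix y assume "y \<in> space (lebesgue_on {0<..<a})"
    then have "ennreal c \<le> rearr f y"
      using rearr_antimono[of y a f] c by auto
    then show "rearr f y - ennreal c + ennreal c = rearr f y"
      by (simp add: diff_add_cancel_ennreal)
  qed
  finally show ?thesis by simp
qed

lemma rearr_le_Linf_norm:
  assumes "f \<in> fspace Linf_norm" "0 \<le> x"
  shows "rearr f x \<le> Linf_norm f"
proof -
  have f: "f \<in> meas_fun" and fin: "Linf_norm f < \<infinity>"
    using assms by (auto simp: fspace_def)
  then obtain M where M: "0 \<le> M" "Linf_norm f = ennreal M"
    by (cases "Linf_norm f") auto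
  have "AE y in lam. e2ennreal \<bar>f y\<bar> \<le> ennreal M"
    using esssup_AE[of "\<lambda>x. e2ennreal \<bar>f x\<bar>" lam] M by (simp add: Linf_norm_def)
  then have "AE y in lam. y \<notin> {y \<in> {0<..}. ereal M < \<bar>f y\<bar>}"
    by (rule AE_mp) (use M in \<open>auto simp: ereal_less_abs_iff\<close>)
  then have "distribution f M = 0"
    unfolding distribution_def using AE_iff_null_sets[OF level_set_measurable[OF f]] by auto
  then show ?thesis
    using M rearr_le_iff[OF f] by simp
qed

section \<open>Measurability of kernel integrals\<close>

lemma AE_lam_iff: "(AE x in lam. P x) \<longleftrightarrow> (AE x in lborel. 0 < x \<longrightarrow> P x)"
  by (simp add: AE_restrict_space_iff AE_completion_iff)

lemma nn_integral_lam: "(\<integral>\<^sup>+ x. g x \<partial>lam) = (\<integral>\<^sup>+ x. g x * indicator {0<..} x \<partial>lborel)"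
  by (simp add: nn_integral_restrict_space nn_integral_completion)

text \<open>Tonelli's theorem will be applied to a product of Borel measures. Lebesgue measurable
  functions are therefore first replaced by Borel ones that agree almost everywhere.\<close>

lemma lam_borel_version:
  fixes g :: "real \<Rightarrow> ennreal"
  assumes "g \<in> borel_measurable lam"
  obtains g' where "g' \<in> borel_measurable borel" "AE x in lborel. 0 < x \<longrightarrow> g x = g' x"
proof -
  have "(\<lambda>x. g x * indicator {0<..} x) \<in> borel_measurable lebesgue"
    using assms by (subst (asm) borel_measurable_restrict_space_iff_ennreal) auto
  then obtain g' where g': "g' \<in> borel_measurable lborel" "AE x in lborel. g x * indicator {0<..} x = g' x"
    using completion_ex_borel_measurable by blast
  have "AE x in lborel. 0 < x \<longrightarrow> g x = g' x"
    by (rule AE_mp[OF g'(2)]) (auto simp: indicator_def)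
  with g'(1) show thesis by (intro that) auto
qed

text \<open>Superlevel sets of \<open>g\<close> and \<open>g'\<close> differ by subsets of null
  sets, and these are measurable in the completion.\<close>

lemma borel_measurable_completion_AE:
  fixes g :: "'a \<Rightarrow> 'b::{linorder_topology, second_countable_topology}"
  assumes g' [measurable]: "g' \<in> borel_measurable M" and ae: "AE x in M. g x = g' x"
  shows "g \<in> borel_measurable (completion M)"
proof (rule borel_measurableI_greater)
  fix c
  have [measurable]: "Measurable.pred (completion M) (\<lambda>x. c < g x \<and> \<not> c < g' x)"
    "Measurable.pred (completion M) (\<lambda>x. c < g' x \<and> \<not> c < g x)"
    by (rule sets_completion_AE, rule AE_mp[OF ae], simp)+
  have [measurable]: "g' \<in> borel_measurable (completion M)"
    by (rule measurable_completion) fact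
  have "Measurable.pred (completion M) (\<lambda>x. (c < g' x \<and> \<not> (c < g' x \<and> \<not> c < g x)) \<or> (c < g x \<and> \<not> c < g' x))"
    by measurable
  also have "(\<lambda>x. (c < g' x \<and> \<not> (c < g' x \<and> \<not> c < g x)) \<or> (c < g x \<and> \<not> c < g' x)) = (\<lambda>x. c < g x)"
    by auto
  finally show "{x \<in> space (completion M). c < g x} \<in> sets (completion M)"
    by (simp add: pred_def)
qed

lemma borel_measurable_lam_AE:
  fixes g :: "real \<Rightarrow> ennreal"
  assumes [measurable]: "g' \<in> borel_measurable borel" and ae: "AE x in lborel. 0 < x \<longrightarrow> g x = g' x"
  shows "g \<in> borel_measurable lam"
proof -
  have "(\<lambda>x. g x * indicator {0<..} x) \<in> borel_measurable lebesgue"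
  proof (rule borel_measurable_completion_AE)
    show "(\<lambda>x. g' x * indicator {0<..} x) \<in> borel_measurable lborel" by measurable
    show "AE x in lborel. g x * indicator {0<..} x = g' x * indicator {0<..} x"
      by (rule AE_mp[OF ae]) (auto simp: indicator_def)
  qed
  then show ?thesis
    by (subst borel_measurable_restrict_space_iff_ennreal) auto
qed

text \<open>Almost every section of a null set is null. The exchange of variables is carried out for
  a Borel null set \<open>N\<close> containing the exceptional set; \<open>t\<close> comes first
  because the kernel is integrated in \<open>s\<close> for fixed \<open>t\<close>.\<close>

lemma AE_lborel_prod_swap:
  fixes P :: "real \<times> real \<Rightarrow> bool"
  assumes "AE p in lborel. P p"
  shows "AE t in lborel. AE s in lborel. P (s, t)"
proof -
  obtain N where N: "N \<in> null_sets lborel" "{p. \<not> P p} \<subseteq> N"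
    using assms by (auto simp: eventually_ae_filter)
  have [measurable]: "N \<in> sets (lborel \<Otimes>\<^sub>M lborel)"
    unfolding lborel_prod using N by auto
  have "AE p in lborel \<Otimes>\<^sub>M lborel. p \<notin> N"
    unfolding lborel_prod by (rule AE_not_in[OF N(1)])
  then have "AE s in lborel. AE t in lborel. (s, t) \<notin> N"
    by (rule lborel_pair.AE_pair)
  moreover have "{p \<in> space (lborel \<Otimes>\<^sub>M lborel). (fst p, snd p) \<notin> N} \<in> sets (lborel \<Otimes>\<^sub>M lborel)"
    by measurable
  ultimately have "AE t in lborel. AE s in lborel. (s, t) \<notin> N"
    using lborel_pair.AE_commute[of "\<lambda>s t. (s, t) \<notin> N"] by blast
  then show ?thesis
    by (rule AE_mp) (use N(2) in \<open>auto elim!: eventually_mono\<close>)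
qed

text \<open>The kernel, extended by 0 outside the quadrant, is measurable for the completed product
  measure and so has a Borel representative \<open>k'\<close>. Fubini's theorem for null sets passes
  the agreement on to almost every section.\<close>

lemma kernel_borel_version:
  assumes "admissible_kernel k"
  obtains k' where "k' \<in> borel_measurable (borel \<Otimes>\<^sub>M borel)"
    "AE t in lborel. 0 < t \<longrightarrow> (AE s in lborel. 0 < s \<longrightarrow> k s t = k' (s, t))"
proof -
  let ?Q = "{0<..} \<times> {0<..} :: (real \<times> real) set"
  have Q: "?Q \<in> sets lebesgue"
    by (intro sets_completionI_sets) (simp add: borel_open open_Times)
  have "(\<lambda>p. (case p of (s, t) \<Rightarrow> k s t) * indicator ?Q p) \<in> borel_measurable lebesgue"
    using assms Q unfolding admissible_kernel_def
    by (subst (asm) borel_measurable_restrict_space_iff_ennreal) auto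
  then obtain k' where k': "k' \<in> borel_measurable lborel"
    "AE p in lborel. (case p of (s, t) \<Rightarrow> k s t) * indicator ?Q p = k' p"
    using completion_ex_borel_measurable by blast
  show thesis
  proof
    show "k' \<in> borel_measurable (borel \<Otimes>\<^sub>M borel)"
      using k'(1) by (simp add: borel_prod)
    show "AE t in lborel. 0 < t \<longrightarrow> (AE s in lborel. 0 < s \<longrightarrow> k s t = k' (s, t))"
      by (rule AE_mp[OF AE_lborel_prod_swap[OF k'(2)]])
        (auto elim!: eventually_mono simp: indicator_def)
  qed
qed

text \<open>The operator on nonnegative functions, where no cancellation can occur.\<close>

definition kernel_int :: "(real \<Rightarrow> real \<Rightarrow> ennreal) \<Rightarrow> (real \<Rightarrow> ennreal) \<Rightarrow> real \<Rightarrow> ennreal" where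
  "kernel_int k g t = (\<integral>\<^sup>+ s. g s * k s t \<partial>lam)"

text \<open>For almost every \<open>t\<close> the integral is unchanged when \<open>g\<close> and
  \<open>k\<close> are replaced by Borel versions, and for these it depends measurably on
  \<open>t\<close> by Tonelli's theorem.\<close>

lemma kernel_int_measurable:
  assumes "admissible_kernel k" "g \<in> borel_measurable lam"
  shows "kernel_int k g \<in> borel_measurable lam"
proof -
  obtain k' where [measurable]: "k' \<in> borel_measurable (borel \<Otimes>\<^sub>M borel)"
    and k': "AE t in lborel. 0 < t \<longrightarrow> (AE s in lborel. 0 < s \<longrightarrow> k s t = k' (s, t))"
    using kernel_borel_version[OF assms(1)] .
  obtain g' where [measurable]: "g' \<in> borel_measurable borel"
    and g': "AE s in lborel. 0 < s \<longrightarrow> g s = g' s"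
    using lam_borel_version[OF assms(2)] .
  show ?thesis
  proof (rule borel_measurable_lam_AE)
    have "(\<lambda>t. \<integral>\<^sup>+ s. g' s * k' (s, t) * indicator {0<..} s \<partial>lborel) \<in> borel_measurable lborel"
      by measurable
    then show "(\<lambda>t. \<integral>\<^sup>+ s. g' s * k' (s, t) * indicator {0<..} s \<partial>lborel) \<in> borel_measurable borel"
      by simp
    have "kernel_int k g t = (\<integral>\<^sup>+ s. g' s * k' (s, t) * indicator {0<..} s \<partial>lborel)"
      if "AE s in lborel. 0 < s \<longrightarrow> k s t = k' (s, t)" for t
      unfolding kernel_int_def nn_integral_lam
      by (rule nn_integral_cong_AE, rule AE_mp[OF that], rule AE_mp[OF g']) (auto simp: indicator_def)
    with k' show "AE t in lborel. 0 < t \<longrightarrow>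
        kernel_int k g t = (\<integral>\<^sup>+ s. g' s * k' (s, t) * indicator {0<..} s \<partial>lborel)"
      by (auto elim!: eventually_mono)
  qed
qed

section \<open>The operator on signed functions\<close>

lemma e2ennreal_mult_enn2ereal: "e2ennreal (x * enn2ereal c) = e2ennreal x * c"
proof (cases c)
  case (real r)
  then show ?thesis
    by (cases x; cases "r = 0") (auto simp: ennreal_mult' ennreal_mult'' enn2ereal_ennreal ennreal_top_mult e2ennreal_neg zero_ennreal.rep_eq)
next
  case top
  then show ?thesis
    by (cases x rule: ereal_cases; cases x "0::ereal" rule: linorder_cases)
      (auto simp: e2ennreal_neg ennreal_mult_top top_ereal_def ennreal_neg)
qed

lemma e2ennreal_le_abs: "e2ennreal x \<le> e2ennreal \<bar>x\<bar>" "e2ennreal (- x) \<le> e2ennreal \<bar>x\<bar>"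
  by (cases x; auto simp: e2ennreal_neg intro: ennreal_leI)+

text \<open>As \<open>k\<close> is nonnegative, the positive and negative parts of the integrand are
  those of \<open>f\<close> multiplied by \<open>k\<close>; \<open>e2ennreal\<close> takes positive
  parts.\<close>

lemma kernel_op_eq:
  "kernel_op k f t = enn2ereal (kernel_int k (\<lambda>s. e2ennreal (f s)) t)
    - enn2ereal (kernel_int k (\<lambda>s. e2ennreal (- f s)) t)"
  unfolding kernel_op_def ext_integral_def kernel_int_def
  by (simp add: e2ennreal_mult_enn2ereal flip: ereal_mult_minus_left)

lemma kernel_op_measurable:
  assumes k: "admissible_kernel k" and [measurable]: "f \<in> meas_fun"
  shows "kernel_op k f \<in> meas_fun"
proof -
  have [measurable]: "kernel_int k (\<lambda>s. e2ennreal (f s)) \<in> borel_measurable lam"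
    "kernel_int k (\<lambda>s. e2ennreal (- f s)) \<in> borel_measurable lam"
    by (intro kernel_int_measurable[OF k]; measurable)+
  show ?thesis
    unfolding kernel_op_eq[abs_def] by measurable
qed

text \<open>The difference of two nonnegative numbers is at most the larger one in absolute value.
  If one of them is infinite, so is the right-hand side; hence the value given to \<infinity> -
  \<infinity> is harmless.\<close>

lemma abs_kernel_op_le:
  "e2ennreal \<bar>kernel_op k f t\<bar> \<le> kernel_int k (\<lambda>s. e2ennreal \<bar>f s\<bar>) t"
proof -
  have "e2ennreal \<bar>enn2ereal a - enn2ereal b\<bar> \<le> c" if "a \<le> c" "b \<le> c" for a b c
    using that
    by (cases a; cases b; cases c) (auto simp: enn2ereal_ennreal ennreal_le_iff2 abs_if)
  moreover have "kernel_int k (\<lambda>s. e2ennreal (f s)) t \<le> kernel_int k (\<lambda>s. e2ennreal \<bar>f s\<bar>) t"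
    "kernel_int k (\<lambda>s. e2ennreal (- f s)) t \<le> kernel_int k (\<lambda>s. e2ennreal \<bar>f s\<bar>) t"
    unfolding kernel_int_def
    by (auto intro!: nn_integral_mono mult_right_mono e2ennreal_le_abs)
  ultimately show ?thesis
    unfolding kernel_op_eq by blast
qed

lemma kernel_op_of_enn:
  "kernel_op k (\<lambda>s. enn2ereal (g s)) t = enn2ereal (kernel_int k g t)"
proof -
  have "e2ennreal (- enn2ereal (g s)) = 0" for s
    by (simp add: e2ennreal_neg)
  then show ?thesis
    unfolding kernel_op_eq by (simp add: kernel_int_def zero_ennreal.rep_eq)
qed

text \<open>The positive part of the integrand is dominated by \<open>|f| k\<close>, and one finite
  part is enough for the integral to make sense.\<close>

lemma kernel_domI:
  assumes k: "admissible_kernel k" and [measurable]: "f \<in> meas_fun"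
    and fin: "AE t in lam. kernel_int k (\<lambda>s. e2ennreal \<bar>f s\<bar>) t < \<infinity>"
  shows "f \<in> kernel_dom k"
proof -
  have "has_ext_integral (\<lambda>s. f s * enn2ereal (k s t))"
    if [measurable]: "(\<lambda>s. k s t) \<in> borel_measurable lam"
      and fin: "kernel_int k (\<lambda>s. e2ennreal \<bar>f s\<bar>) t < \<infinity>" for t
  proof -
    have "(\<integral>\<^sup>+ s. e2ennreal (f s * enn2ereal (k s t)) \<partial>lam) \<le> kernel_int k (\<lambda>s. e2ennreal \<bar>f s\<bar>) t"
      unfolding kernel_int_def e2ennreal_mult_enn2ereal
      by (auto intro!: nn_integral_mono mult_right_mono e2ennreal_le_abs)
    then have "(\<integral>\<^sup>+ s. e2ennreal (f s * enn2ereal (k s t)) \<partial>lam) < \<infinity>"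
      using fin by (rule le_less_trans)
    then show ?thesis
      unfolding has_ext_integral_def by auto
  qed
  moreover have "AE t in lam. (\<lambda>s. k s t) \<in> borel_measurable lam"
    using k unfolding admissible_kernel_def by (auto elim: eventually_mono)
  ultimately show ?thesis
    using fin unfolding kernel_dom_def by (auto elim: eventually_elim2)
qed

section \<open>Functions with bounded averages over intervals\<close>

lemma ball_midpoint: "ball ((a + b) / 2) ((b - a) / 2) = {a<..<b :: real}"
  by (auto simp: ball_eq_greaterThanLessThan field_simps)

text \<open>Vitali's covering theorem provides a disjoint family, so that bounds on single intervals can
  simply be added up.\<close>

lemma open_AE_disjoint_rational_intervals:
  fixes U :: "real set"
  assumes "open U"
  obtains D where "countable D"
    "D \<subseteq> {(a, b). a \<in> \<rat> \<and> b \<in> \<rat> \<and> a < b \<and> {a<..<b} \<subseteq> U}"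
    "disjoint_family_on (\<lambda>(a, b). {a<..<b}) D"
    "negligible (U - (\<Union>(a, b)\<in>D. {a<..<b}))"
proof -
  let ?K = "{(a, b). a \<in> \<rat> \<and> b \<in> \<rat> \<and> a < b \<and> {a<..<b} \<subseteq> U}"
  let ?c = "\<lambda>(a, b). (a + b) / 2 :: real" and ?r = "\<lambda>(a, b). (b - a) / 2 :: real"
  have "\<exists>i. i \<in> ?K \<and> x \<in> ball (?c i) (?r i) \<and> ?r i < d" if "x \<in> U" "0 < d" for x d
  proof -
    obtain e where e: "0 < e" "ball x e \<subseteq> U"
      using \<open>open U\<close> \<open>x \<in> U\<close> openE by blast
    \<comment> \<open>The margin \<open>min d e\<close> does two things: \<open>e\<close> keeps the
      interval inside \<open>U\<close>, and \<open>d\<close> bounds half its length, as Vitali's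
      theorem demands.\<close>
    obtain a where a: "a \<in> \<rat>" "x - min d e < a" "a < x"
      using Rats_dense_in_real[of "x - min d e" x] e(1) \<open>0 < d\<close> by auto
    obtain b where b: "b \<in> \<rat>" "x < b" "b < x + min d e"
      using Rats_dense_in_real[of x "x + min d e"] e(1) \<open>0 < d\<close> by auto
    have "{a<..<b} \<subseteq> ball x e"
      using a b by (auto simp: dist_real_def)
    with e have "(a, b) \<in> ?K" using a b by auto
    moreover have "x \<in> ball (?c (a, b)) (?r (a, b))" "?r (a, b) < d"
      using a b by (auto simp: ball_midpoint)
    ultimately show ?thesis by blast
  qed
  from Vitali_covering_theorem_balls[of U ?K ?c ?r, OF this]
  obtain D where D: "countable D" "D \<subseteq> ?K"
    "pairwise (\<lambda>i j. disjnt (ball (?c i) (?r i)) (ball (?c j) (?r j))) D"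
    "negligible (U - (\<Union>i\<in>D. ball (?c i) (?r i)))"
    by blast
  have eq: "ball (?c i) (?r i) = (case i of (a, b) \<Rightarrow> {a<..<b})" for i
    by (cases i) (simp add: ball_midpoint)
  show thesis
  proof
    show "countable D" by fact
    show "D \<subseteq> ?K" by fact
    show "disjoint_family_on (\<lambda>(a, b). {a<..<b}) D"
      using D(3) unfolding eq by (auto simp: disjoint_family_on_def pairwise_def disjnt_def)
    show "negligible (U - (\<Union>(a, b)\<in>D. {a<..<b}))"
      using D(4) unfolding eq .
  qed
qed

text \<open>By outer regularity \<open>A\<close> lies in an open set \<open>U\<close> of only
  slightly larger measure. Up to a null set \<open>U\<close> is a disjoint union of rational
  intervals, over which the bounds are summed.\<close>

lemma density_le_of_rational_intervals:
  fixes g :: "real \<Rightarrow> ennreal"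
  assumes [measurable]: "g \<in> borel_measurable lam"
    and le: "\<And>a b. a \<in> \<rat> \<Longrightarrow> b \<in> \<rat> \<Longrightarrow> 0 \<le> a \<Longrightarrow> a < b \<Longrightarrow>
      emeasure (density lam g) {a<..<b} \<le> ennreal C * ennreal (b - a)"
    and A [measurable]: "A \<in> sets lam"
  shows "emeasure (density lam g) A \<le> ennreal C * emeasure lam A"
proof -
  let ?\<nu> = "density lam g"
  have A_leb: "A \<in> sets lebesgue" and A_pos: "A \<subseteq> {0<..}"
    using A by (auto simp: sets_restrict_space)
  have "emeasure ?\<nu> A \<le> ennreal C * (emeasure lam A + ennreal e)" if "0 < e" for e
  proof -
    obtain T where T: "open T" "A \<subseteq> T" "T - A \<in> lmeasurable" "emeasure lebesgue (T - A) < ennreal e"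
      using sets_lebesgue_outer_open[OF A_leb \<open>0 < e\<close>] .
    \<comment> \<open>Intersecting with the positive half-line forces nonnegative left endpoints,
      which \<open>le\<close> requires.\<close>
    define U where "U = T \<inter> {0<..}"
    have "open U" "A \<subseteq> U" "U \<subseteq> {0<..}" using T A_pos by (auto simp: U_def)
    obtain D where D: "countable D"
      "D \<subseteq> {(a, b). a \<in> \<rat> \<and> b \<in> \<rat> \<and> a < b \<and> {a<..<b} \<subseteq> U}"
      "disjoint_family_on (\<lambda>(a, b). {a<..<b}) D"
      "negligible (U - (\<Union>(a, b)\<in>D. {a<..<b}))"
      using open_AE_disjoint_rational_intervals[OF \<open>open U\<close>] .
    have D2: "a \<in> \<rat> \<and> b \<in> \<rat> \<and> a < b \<and> {a<..<b} \<subseteq> U" if "(a, b) \<in> D" for a b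
      using that D(2) by auto
    let ?I = "\<lambda>i :: real \<times> real. case i of (a, b) \<Rightarrow> {a<..<b}"
    have sets_lamI: "B \<in> sets lam" if "B \<in> sets lebesgue" "B \<subseteq> {0<..}" for B
      using that by (auto simp: sets_restrict_space_iff)
    have U_sets: "U \<in> sets lam"
      using \<open>open U\<close> \<open>U \<subseteq> {0<..}\<close> by (intro sets_lamI) auto
    have I_pos: "0 \<le> a" if "(a, b) \<in> D" for a b
    proof (rule ccontr)
      assume "\<not> 0 \<le> a"
      \<comment> \<open>For negative \<open>a\<close> the midpoint of \<open>a\<close> and
        \<open>min b 0\<close> would be a nonpositive point of an interval contained in
        \<open>U\<close>.\<close>
      then have "(a + min b 0) / 2 \<in> {a<..<b}" "(a + min b 0) / 2 \<le> 0"
        using D2[OF that] by (auto simp: min_def field_simps)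
      then have "(a + min b 0) / 2 \<in> {0<..}"
        using D2[OF that] \<open>U \<subseteq> {0<..}\<close> by blast
      then show False
        using \<open>(a + min b 0) / 2 \<le> 0\<close> by simp
    qed
    have I_sets: "?I i \<in> sets lam" if "i \<in> D" for i
      using that I_pos by (cases i) (force intro!: sets_lamI)
    have UN_sets: "(\<Union>i\<in>D. ?I i) \<in> sets lam"
      using D(1) I_sets by (intro sets.countable_UN') auto
    have UN_U: "(\<Union>i\<in>D. ?I i) \<subseteq> U" using D2 by auto
    have null_lam: "U - (\<Union>i\<in>D. ?I i) \<in> null_sets lam"
      using D(4) U_sets UN_sets \<open>U \<subseteq> {0<..}\<close>
      by (subst null_sets_restrict_space) (auto simp: negligible_iff_null_sets)
    \<comment> \<open>The uncovered remainder is null for Lebesgue measure, hence also for the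
      density.\<close>
    have "AE x in lam. x \<in> U - (\<Union>i\<in>D. ?I i) \<longrightarrow> g x = 0"
      using AE_not_in[OF null_lam] by (rule AE_mp) (intro AE_I2 impI, blast)
    then have null: "U - (\<Union>i\<in>D. ?I i) \<in> null_sets ?\<nu>"
      unfolding null_sets_density_iff[OF assms(1)] by (intro conjI null_setsD2[OF null_lam])
    have "emeasure ?\<nu> A \<le> emeasure ?\<nu> ((\<Union>i\<in>D. ?I i) \<union> (U - (\<Union>i\<in>D. ?I i)))"
      using U_sets UN_sets \<open>A \<subseteq> U\<close> by (intro emeasure_mono) auto
    also have "\<dots> = emeasure ?\<nu> (\<Union>i\<in>D. ?I i)"
      using null UN_sets by (intro emeasure_Un_null_set) auto
    also have "\<dots> = (\<integral>\<^sup>+ i. emeasure ?\<nu> (?I i) \<partial>count_space D)"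
      using D I_sets by (intro emeasure_UN_countable) auto
    also have "\<dots> \<le> (\<integral>\<^sup>+ i. ennreal C * emeasure lam (?I i) \<partial>count_space D)"
    proof (intro nn_integral_mono)
      fix i assume "i \<in> space (count_space D)"
      then obtain a b where i: "i = (a, b)" "(a, b) \<in> D" by (cases i) auto
      have "emeasure lam {a<..<b} = ennreal (b - a)"
        using D2[OF i(2)] I_pos[OF i(2)] by (subst emeasure_restrict_space) auto
      then show "emeasure ?\<nu> (?I i) \<le> ennreal C * emeasure lam (?I i)"
        using D2[OF i(2)] I_pos[OF i(2)] le[of a b] i by simp
    qed
    also have "\<dots> = ennreal C * (\<integral>\<^sup>+ i. emeasure lam (?I i) \<partial>count_space D)"
      by (rule nn_integral_cmult) simp
    also have "(\<integral>\<^sup>+ i. emeasure lam (?I i) \<partial>count_space D) = emeasure lam (\<Union>i\<in>D. ?I i)"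
      using D I_sets by (intro emeasure_UN_countable[symmetric]) auto
    also have "\<dots> \<le> emeasure lam U"
      using UN_U U_sets by (rule emeasure_mono)
    also have "emeasure lam U \<le> emeasure lam A + ennreal e"
    proof -
      have "emeasure lam U \<le> emeasure lam A + emeasure lam (U - A)"
        using U_sets A \<open>A \<subseteq> U\<close> emeasure_subadditive[of A lam "U - A"] by (simp add: Un_absorb1)
      also have "emeasure lam (U - A) = emeasure lebesgue (U - A)"
        using \<open>U \<subseteq> {0<..}\<close> by (intro emeasure_restrict_space) auto
      also have "\<dots> \<le> emeasure lebesgue (T - A)"
        using T by (intro emeasure_mono) (auto simp: U_def)
      also have "\<dots> \<le> ennreal e" using T(4) by simp
      finally show ?thesis by (simp add: add_left_mono)
    qed
    finally show ?thesis by (simp add: mult_left_mono)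
  qed note approx = this
  show ?thesis
  proof (cases "0 < C")
    case False
    \<comment> \<open>Here \<open>ennreal C\<close> is 0, so a single value of \<open>e\<close>
      settles the claim.\<close>
    then show ?thesis using approx[of 1] by (simp add: ennreal_neg)
  next
    case True
    show ?thesis
    proof (rule ennreal_le_epsilon)
      fix e :: real assume "0 < e"
      have "emeasure ?\<nu> A \<le> ennreal C * (emeasure lam A + ennreal (e / C))"
        using \<open>0 < C\<close> \<open>0 < e\<close> by (intro approx) simp
      also have "\<dots> = ennreal C * emeasure lam A + ennreal e"
        using \<open>0 < C\<close> \<open>0 < e\<close> by (simp add: distrib_left flip: ennreal_mult')
      finally show "emeasure ?\<nu> A \<le> ennreal C * emeasure lam A + ennreal e" .
    qed
  qed
qed

text \<open>On a set \<open>A\<close> where \<open>g > C + 1/(n+1)\<close>, the bound for densities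
  gives (C + 1/(n+1)) |A| \<le> C |A|. If |A| is finite, it must be 0.\<close>

lemma AE_le_of_rational_intervals:
  fixes g :: "real \<Rightarrow> ennreal"
  assumes g [measurable]: "g \<in> borel_measurable lam" and "0 \<le> C"
    and le: "\<And>a b. a \<in> \<rat> \<Longrightarrow> b \<in> \<rat> \<Longrightarrow> 0 \<le> a \<Longrightarrow> a < b \<Longrightarrow>
      (\<integral>\<^sup>+ s. g s * indicator {a<..<b} s \<partial>lam) \<le> ennreal (C * (b - a))"
  shows "AE s in lam. g s \<le> ennreal C"
proof -
  \<comment> \<open>The cut-off \<open>s < real n\<close> makes the measure finite, so that it can
    be cancelled. One index serves for the cut-off and for the gap, which is why \<open>n\<close> is
    later chosen above both \<open>s\<close> and \<open>m\<close>.\<close>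
  let ?A = "\<lambda>n. {s \<in> space lam. s < real n \<and> ennreal (C + 1 / real (Suc n)) < g s}"
  have [measurable]: "(\<lambda>s. s) \<in> borel_measurable lam"
    by (simp add: measurable_completion measurable_restrict_space1)
  have A [measurable]: "?A n \<in> sets lam" for n by measurable
  have "?A n \<in> null_sets lam" for n
  proof -
    have "emeasure lam (?A n) \<le> emeasure lam {0<..<real n}"
      by (intro emeasure_mono) (auto simp: sets_restrict_space_iff)
    also have "\<dots> = ennreal n"
      by (subst emeasure_restrict_space) auto
    finally obtain r where r: "0 \<le> r" "emeasure lam (?A n) = ennreal r"
      by (cases "emeasure lam (?A n)") (auto simp: top_unique)
    have "ennreal (C + 1 / real (Suc n)) * emeasure lam (?A n) =
        (\<integral>\<^sup>+ s. ennreal (C + 1 / real (Suc n)) * indicator (?A n) s \<partial>lam)"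
      by (rule nn_integral_cmult_indicator[symmetric]) fact
    also have "\<dots> \<le> (\<integral>\<^sup>+ s. g s * indicator (?A n) s \<partial>lam)"
      by (intro nn_integral_mono) (auto simp: indicator_def)
    also have "\<dots> = emeasure (density lam g) (?A n)"
      by (rule emeasure_density[symmetric]) fact+
    also have "\<dots> \<le> ennreal C * emeasure lam (?A n)"
    proof (rule density_le_of_rational_intervals)
      fix a b :: real assume ab: "a \<in> \<rat>" "b \<in> \<rat>" "0 \<le> a" "a < b"
      then have "{a<..<b} \<in> sets lam" by (auto simp: sets_restrict_space_iff)
      then show "emeasure (density lam g) {a<..<b} \<le> ennreal C * ennreal (b - a)"
        using le[OF ab] \<open>0 \<le> C\<close> ab by (simp add: emeasure_density ennreal_mult')
    qed fact+
    finally have "ennreal ((C + 1 / real (Suc n)) * r) \<le> ennreal (C * r)"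
      using r \<open>0 \<le> C\<close> by (simp add: ennreal_mult'' del: ennreal_plus)
    then have "(C + 1 / real (Suc n)) * r \<le> C * r"
      using r \<open>0 \<le> C\<close> by (subst (asm) ennreal_le_iff) auto
    then have "1 / real (Suc n) * r \<le> 0"
      by (simp add: algebra_simps)
    then have "r = 0"
      using r by (simp add: field_simps mult_le_0_iff)
    with r show ?thesis using A by (auto intro!: null_setsI)
  qed
  then have "AE s in lam. \<forall>n. s \<notin> ?A n"
    unfolding AE_all_countable by (intro allI AE_not_in)
  then show ?thesis
  proof (rule AE_mp, intro AE_I2 impI)
    fix s assume s: "s \<in> space lam" "\<forall>n. s \<notin> ?A n"
    show "g s \<le> ennreal C"
    proof (rule ennreal_le_epsilon)
      fix e :: real assume "0 < e"
      obtain m where m: "1 / real (Suc m) < e" using nat_approx_posE[OF \<open>0 < e\<close>] by auto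
      obtain n where n: "s < real n" "m \<le> n"
        using reals_Archimedean2[of "max s (real m)"] by (auto simp: less_imp_le)
      have "g s \<le> ennreal (C + 1 / real (Suc n))"
        using s n by auto
      also have "\<dots> \<le> ennreal (C + e)"
      proof (rule ennreal_leI)
        have "1 / real (Suc n) \<le> 1 / real (Suc m)" using n by (simp add: frac_le)
        with m show "C + 1 / real (Suc n) \<le> C + e" by linarith
      qed
      finally show "g s \<le> ennreal C + ennreal e"
        using \<open>0 \<le> C\<close> \<open>0 < e\<close> by simp
    qed
  qed
qed

section \<open>Bounds for the kernel operator\<close>

text \<open>The bound on \<open>k\<close> is spent only on the part of |f| above \<open>c\<close>.
  The constant part keeps the kernel and yields c w(t), since
  \<open>kernel_int k (\<lambda>_. 1)\<close> is w.\<close>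

lemma kernel_int_le_truncation:
  assumes [measurable]: "f \<in> meas_fun" "(\<lambda>s. k s t) \<in> borel_measurable lam"
    and le: "AE s in lam. k s t \<le> ennreal C"
  shows "kernel_int k (\<lambda>s. e2ennreal \<bar>f s\<bar>) t \<le>
    ennreal C * (\<integral>\<^sup>+ s. (e2ennreal \<bar>f s\<bar> - c) \<partial>lam) + c * kernel_int k (\<lambda>_. 1) t"
proof -
  have "kernel_int k (\<lambda>s. e2ennreal \<bar>f s\<bar>) t \<le>
      (\<integral>\<^sup>+ s. ennreal C * (e2ennreal \<bar>f s\<bar> - c) + c * k s t \<partial>lam)"
    unfolding kernel_int_def
  proof (rule nn_integral_mono_AE, rule AE_mp[OF le], intro AE_I2 impI)
    fix s assume "k s t \<le> ennreal C"
    have "e2ennreal \<bar>f s\<bar> \<le> (e2ennreal \<bar>f s\<bar> - c) + c"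
      by (metis add.commute ennreal_minus_le_iff order_refl)
    then have "e2ennreal \<bar>f s\<bar> * k s t \<le> ((e2ennreal \<bar>f s\<bar> - c) + c) * k s t"
      by (rule mult_right_mono) simp
    also have "\<dots> = k s t * (e2ennreal \<bar>f s\<bar> - c) + c * k s t"
      by (subst distrib_right) (simp add: mult.commute)
    also have "\<dots> \<le> ennreal C * (e2ennreal \<bar>f s\<bar> - c) + c * k s t"
      using \<open>k s t \<le> ennreal C\<close> by (intro add_right_mono mult_right_mono) auto
    finally show "e2ennreal \<bar>f s\<bar> * k s t \<le> ennreal C * (e2ennreal \<bar>f s\<bar> - c) + c * k s t" .
  qed
  also have "\<dots> = ennreal C * (\<integral>\<^sup>+ s. (e2ennreal \<bar>f s\<bar> - c) \<partial>lam) + c * kernel_int k (\<lambda>_. 1) t"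
    by (simp add: nn_integral_add nn_integral_cmult kernel_int_def)
  finally show ?thesis .
qed

lemma kernel_int_AE_le_truncation:
  assumes k: "admissible_kernel k" and f: "f \<in> meas_fun"
    and le: "AE t in lam. Linf_norm (\<lambda>s. enn2ereal (k s t)) \<le> ennreal C"
  shows "AE t in lam. kernel_int k (\<lambda>s. e2ennreal \<bar>f s\<bar>) t \<le>
    ennreal C * (\<integral>\<^sup>+ s. (e2ennreal \<bar>f s\<bar> - c) \<partial>lam) + c * kernel_int k (\<lambda>_. 1) t"
proof -
  have "AE t in lam. (\<lambda>s. k s t) \<in> borel_measurable lam"
    using k unfolding admissible_kernel_def by (auto elim: eventually_mono)
  with le show ?thesis
  proof eventually_elim
    fix t assume t: "Linf_norm (\<lambda>s. enn2ereal (k s t)) \<le> ennreal C" "(\<lambda>s. k s t) \<in> borel_measurable lam"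
    have "AE s in lam. k s t \<le> Linf_norm (\<lambda>s. enn2ereal (k s t))"
      using esssup_AE[of "\<lambda>s. k s t" lam] by (simp add: Linf_norm_def)
    then have "AE s in lam. k s t \<le> ennreal C"
      by (rule AE_mp) (use t(1) order_trans in auto)
    then show "kernel_int k (\<lambda>s. e2ennreal \<bar>f s\<bar>) t \<le>
        ennreal C * (\<integral>\<^sup>+ s. (e2ennreal \<bar>f s\<bar> - c) \<partial>lam) + c * kernel_int k (\<lambda>_. 1) t"
      by (rule kernel_int_le_truncation[where k = k and t = t, OF f t(2)])
  qed
qed

lemma e2ennreal_abs_add_le: "e2ennreal \<bar>x + y\<bar> \<le> e2ennreal \<bar>x\<bar> + e2ennreal \<bar>y\<bar>"
  by (cases x; cases y) (auto simp flip: ennreal_plus intro!: ennreal_leI)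

text \<open>Cutting |f| at the level \<open>Linf_norm h\<close> leaves at most |g|, which is
  integrable, and w is finite almost everywhere by admissibility. So the truncation bound is finite
  for almost every \<open>t\<close>.\<close>

lemma L1_plus_Linf_subset_kernel_dom:
  assumes k: "admissible_kernel k"
    and le: "AE t in lam. Linf_norm (\<lambda>s. enn2ereal (k s t)) \<le> ennreal C"
  shows "L1_plus_Linf \<subseteq> kernel_dom k"
proof
  fix f assume "f \<in> L1_plus_Linf"
  then obtain g h where f: "f \<in> meas_fun" and g: "g \<in> fspace L1_norm" and h: "h \<in> fspace Linf_norm"
    and eq: "AE x in lam. f x = g x + h x"
    unfolding L1_plus_Linf_def by blast
  have h_le: "AE x in lam. e2ennreal \<bar>h x\<bar> \<le> Linf_norm h"
    unfolding Linf_norm_def by (rule esssup_AE)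
  have "(\<integral>\<^sup>+ s. (e2ennreal \<bar>f s\<bar> - Linf_norm h) \<partial>lam) \<le> L1_norm g"
    unfolding L1_norm_def
  proof (rule nn_integral_mono_AE, rule AE_mp[OF eq], rule AE_mp[OF h_le], intro AE_I2 impI)
    fix s assume s: "e2ennreal \<bar>h s\<bar> \<le> Linf_norm h" "f s = g s + h s"
    have "e2ennreal \<bar>f s\<bar> \<le> Linf_norm h + e2ennreal \<bar>g s\<bar>"
      using e2ennreal_abs_add_le[of "g s" "h s"] s by (metis add.commute add_left_mono order_trans)
    then show "e2ennreal \<bar>f s\<bar> - Linf_norm h \<le> e2ennreal \<bar>g s\<bar>"
      using h by (subst ennreal_minus_le_iff) (auto simp: fspace_def)
  qed
  then have A: "ennreal C * (\<integral>\<^sup>+ s. (e2ennreal \<bar>f s\<bar> - Linf_norm h) \<partial>lam) < \<infinity>"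
    using g by (auto simp: fspace_def ennreal_mult_less_top intro: le_less_trans)
  have "AE t in lam. kernel_int k (\<lambda>_. 1) t < \<infinity>"
    using k unfolding admissible_kernel_def kernel_int_def by (auto elim: eventually_mono)
  with kernel_int_AE_le_truncation[OF k f le, of "Linf_norm h"]
  have "AE t in lam. kernel_int k (\<lambda>s. e2ennreal \<bar>f s\<bar>) t < \<infinity>"
  proof eventually_elim
    case (elim t)
    have "Linf_norm h * kernel_int k (\<lambda>_. 1) t < \<infinity>"
      using h elim(2) by (simp add: fspace_def ennreal_mult_less_top)
    with A have "ennreal C * (\<integral>\<^sup>+ s. (e2ennreal \<bar>f s\<bar> - Linf_norm h) \<partial>lam) +
        Linf_norm h * kernel_int k (\<lambda>_. 1) t < \<infinity>"
      by simp
    with elim(1) show ?case by (rule le_less_trans)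
  qed
  then show "f \<in> kernel_dom k"
    by (rule kernel_domI[OF k f])
qed

lemma kernel_one_measurable:
  "admissible_kernel k \<Longrightarrow> (\<lambda>t. enn2ereal (kernel_int k (\<lambda>_. 1) t)) \<in> meas_fun"
  using kernel_int_measurable[of k "\<lambda>_. 1"] by simp

text \<open>Almost everywhere that w \<le> C a, the truncation bound at the level
  \<open>c = rearr f a\<close> gives |K f| \<le> B. Hence {|K f| > B} is contained in {w > C a} up
  to a null set, and the latter has measure at most \<open>x\<close> by \<open>rw\<close>.\<close>

lemma rearr_kernel_op_le:
  assumes k: "admissible_kernel k" and f: "f \<in> meas_fun" and "0 < C" "0 < a"
    and le: "AE t in lam. Linf_norm (\<lambda>s. enn2ereal (k s t)) \<le> ennreal C"
    and rw: "rearr (\<lambda>t. enn2ereal (kernel_int k (\<lambda>_. 1) t)) x \<le> ennreal (C * a)"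
  shows "rearr (kernel_op k f) x \<le> ennreal C * (\<integral>\<^sup>+ s. rearr f s \<partial>lebesgue_on {0<..<a})"
proof (cases "rearr f a")
  case top
  \<comment> \<open>If \<open>rearr f a\<close> is infinite, then by monotonicity so is
    \<open>rearr f\<close> on all of (0,a), and the right-hand side is infinite.\<close>
  have "(\<integral>\<^sup>+ s. \<infinity> \<partial>lebesgue_on {0<..<a}) \<le> (\<integral>\<^sup>+ s. rearr f s \<partial>lebesgue_on {0<..<a})"
    using top rearr_antimono[of _ a f] by (intro nn_integral_mono) (auto simp: top_unique)
  then show ?thesis
    using \<open>0 < C\<close> \<open>0 < a\<close> by (simp add: emeasure_restrict_space ennreal_top_mult ennreal_mult_top top_unique)
next
  case (real c)
  let ?W = "\<lambda>t. enn2ereal (kernel_int k (\<lambda>_. 1) t)"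
  let ?A = "\<integral>\<^sup>+ s. (e2ennreal \<bar>f s\<bar> - ennreal c) \<partial>lam"
  have I: "?A + ennreal c * ennreal a \<le> (\<integral>\<^sup>+ s. rearr f s \<partial>lebesgue_on {0<..<a})"
    using real \<open>0 < a\<close> by (intro nn_integral_truncation_le_rearr f) auto
  show ?thesis
  proof (cases ?A)
    case top
    with I \<open>0 < C\<close> show ?thesis by (simp add: top_unique ennreal_mult_top)
  next
    case A: (real A)
    \<comment> \<open>This is the truncation bound with w replaced by C a.\<close>
    define B where "B = C * (A + c * a)"
    have "0 \<le> B" using A real \<open>0 < C\<close> \<open>0 < a\<close> by (simp add: B_def)
    have "distribution (kernel_op k f) B \<le> distribution ?W (C * a)"
      unfolding distribution_def
    proof (rule emeasure_mono_AE)
      show "{y \<in> {0<..}. ereal (C * a) < \<bar>?W y\<bar>} \<in> sets lam"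
        by (rule level_set_measurable[OF kernel_one_measurable[OF k]])
      show "AE t in lam. t \<in> {y \<in> {0<..}. ereal B < \<bar>kernel_op k f y\<bar>} \<longrightarrow>
          t \<in> {y \<in> {0<..}. ereal (C * a) < \<bar>?W y\<bar>}"
        using kernel_int_AE_le_truncation[OF k f le, of "ennreal c"]
      proof eventually_elim
        case (elim t)
        have "ereal (C * a) < \<bar>?W t\<bar>" if "ereal B < \<bar>kernel_op k f t\<bar>"
        proof (rule ccontr)
          assume "\<not> ereal (C * a) < \<bar>?W t\<bar>"
          then have "\<not> ennreal (C * a) < e2ennreal \<bar>?W t\<bar>"
            using \<open>0 < C\<close> \<open>0 < a\<close> by (subst ereal_less_abs_iff[symmetric]) auto
          then have "kernel_int k (\<lambda>_. 1) t \<le> ennreal (C * a)"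
            by simp
          then have "ennreal C * ?A + ennreal c * kernel_int k (\<lambda>_. 1) t \<le> ennreal C * ?A + ennreal c * ennreal (C * a)"
            by (intro add_left_mono mult_left_mono) auto
          also have "\<dots> = ennreal B"
            using A real \<open>0 < C\<close> \<open>0 < a\<close> unfolding B_def
            by (simp add: distrib_left ac_simps ennreal_mult')
          finally have "e2ennreal \<bar>kernel_op k f t\<bar> \<le> ennreal B"
            using elim abs_kernel_op_le[of k f t] by (meson order_trans)
          with that \<open>0 \<le> B\<close> show False by (simp add: ereal_less_abs_iff)
        qed
        then show ?case by auto
      qed
    qed
    also have "\<dots> \<le> ennreal x"
      using rw \<open>0 < C\<close> \<open>0 < a\<close> by (subst (asm) rearr_le_iff[OF kernel_one_measurable[OF k]]) auto
    finally have "rearr (kernel_op k f) x \<le> ennreal B"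
      using rearr_le_iff[OF kernel_op_measurable[OF k f] \<open>0 \<le> B\<close>] by simp
    also have "ennreal B = ennreal C * (?A + ennreal c * ennreal a)"
      using A real \<open>0 < C\<close> \<open>0 < a\<close> by (simp add: B_def ennreal_mult')
    also have "\<dots> \<le> ennreal C * (\<integral>\<^sup>+ s. rearr f s \<partial>lebesgue_on {0<..<a})"
      using I by (rule mult_left_mono) simp
    finally show ?thesis .
  qed
qed

section \<open>From the rearrangement estimate to operator norms\<close>

text \<open>If \<open>rearr f e\<close> exceeded the bound for some \<open>e > 0\<close>,
  monotonicity would make it exceed the bound on all of (0,e), a set of positive measure. So the
  level \<open>r\<close> is exceeded on a set of measure at most \<open>e\<close> for every
  \<open>e\<close>.\<close>

lemma Linf_norm_le_of_rearr_le:
  assumes f [measurable]: "f \<in> meas_fun" and le: "AE t in lam. rearr f t \<le> c"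
  shows "Linf_norm f \<le> c"
proof (cases c)
  case (real r)
  have "distribution f r \<le> ennreal e" if "0 < e" for e
  proof (rule ccontr)
    assume "\<not> distribution f r \<le> ennreal e"
    then have "ennreal r < rearr f e"
      using real f by (simp add: less_rearr_iff)
    then have "t \<notin> {0<..<e}" if "rearr f t \<le> c" for t
      using that real rearr_antimono[of t e f] by (auto dest: order_trans)
    then have "AE t in lam. t \<notin> {0<..<e}"
      using le by (auto elim: eventually_mono)
    then have "emeasure lam {0<..<e} = 0"
      by (subst (asm) AE_iff_null_sets[symmetric]) (auto simp: sets_restrict_space_iff)
    then show False
      using that by (subst (asm) emeasure_restrict_space) auto
  qed
  then have "distribution f r = 0"
    by (metis ennreal_le_epsilon add_0 le_zero_eq)
  then have "AE t in lam. t \<notin> {y \<in> {0<..}. ereal r < \<bar>f y\<bar>}"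
    unfolding distribution_def by (intro AE_not_in null_setsI level_set_measurable f)
  then have "AE t in lam. e2ennreal \<bar>f t\<bar> \<le> c"
    by (rule AE_mp) (use real in \<open>auto simp: ereal_less_abs_iff\<close>)
  then show ?thesis
    unfolding Linf_norm_def by (intro esssup_I) auto
qed simp

text \<open>The estimate is required on the whole space and not just on the unit ball:
  \<open>T\<close>, \<open>N\<close> and \<open>N'\<close> are arbitrary, so scaling could not
  supply the mapping property.\<close>

lemma bounded_opI:
  assumes "fspace N \<subseteq> D" "\<And>f. f \<in> fspace N \<Longrightarrow> T f \<in> meas_fun"
    and le: "\<And>f. f \<in> fspace N \<Longrightarrow> N' (T f) \<le> ennreal C * N f"
  shows "bounded_op D T N N' \<and> op_norm N N' T \<le> ennreal C"
proof -
  have "op_norm N N' T \<le> ennreal C"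
    unfolding op_norm_def
  proof (rule SUP_least)
    fix f assume f: "f \<in> {f \<in> fspace N. N f \<le> 1}"
    then have "ennreal C * N f \<le> ennreal C * 1"
      by (intro mult_left_mono) auto
    with le[of f] f show "N' (T f) \<le> ennreal C" by (auto intro: order_trans)
  qed
  moreover have "T f \<in> fspace N'" if "f \<in> fspace N" for f
    using assms(2)[OF that] le[OF that] that
    by (auto simp: fspace_def ennreal_mult_less_top intro: le_less_trans)
  ultimately show ?thesis
    using assms(1) by (auto simp: bounded_op_def intro: le_less_trans)
qed

lemma fspace_subset_L1_plus_Linf:
  "fspace L1_norm \<subseteq> L1_plus_Linf" "fspace Linf_norm \<subseteq> L1_plus_Linf"
proof -
  have 0: "(\<lambda>_. 0) \<in> fspace L1_norm" "(\<lambda>_. 0) \<in> fspace Linf_norm"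
    using esssup_I[of "\<lambda>_. 0" lam "0::ennreal"] by (auto simp: fspace_def L1_norm_def Linf_norm_def e2ennreal_neg)
  show "fspace L1_norm \<subseteq> L1_plus_Linf"
  proof
    fix f assume f: "f \<in> fspace L1_norm"
    then show "f \<in> L1_plus_Linf"
      unfolding L1_plus_Linf_def
      by (intro CollectI conjI bexI[OF _ f] bexI[OF _ 0(2)]) (auto simp: fspace_def)
  qed
  show "fspace Linf_norm \<subseteq> L1_plus_Linf"
  proof
    fix f assume f: "f \<in> fspace Linf_norm"
    then show "f \<in> L1_plus_Linf"
      unfolding L1_plus_Linf_def
      by (intro CollectI conjI bexI[OF _ 0(1)] bexI[OF _ f]) (auto simp: fspace_def)
  qed
qed

lemma rearr_cong_on: "(\<And>t. 0 < t \<Longrightarrow> f t = g t) \<Longrightarrow> rearr f = rearr g"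
proof -
  assume "\<And>t. 0 < t \<Longrightarrow> f t = g t"
  then have "{y \<in> {0<..}. ereal t < \<bar>f y\<bar>} = {y \<in> {0<..}. ereal t < \<bar>g y\<bar>}" for t
    by auto
  then show ?thesis unfolding rearr_def by simp
qed

text \<open>Since \<open>rearr f\<close> is at most \<open>Linf_norm f\<close>, the integral over
  (0, 1/\<phi>(t)) is at most \<open>Linf_norm f\<close> divided by \<phi>(t), and the weight
  cancels.\<close>

lemma m_norm_kernel_op_le:
  assumes k: "admissible_kernel k" and \<phi>: "\<And>t. 0 < t \<Longrightarrow> 0 < \<phi> t" "mono_on {0<..} \<phi>"
    and f: "f \<in> fspace Linf_norm"
    and le: "AE t in lam. rearr (kernel_op k f) t
               \<le> ennreal C * (\<integral>\<^sup>+ s. rearr f s \<partial>lebesgue_on {0<..<1 / \<phi> t})"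
  shows "m_norm \<phi> (kernel_op k f) \<le> ennreal C * Linf_norm f"
  unfolding m_norm_def
proof (rule esssup_I)
  \<comment> \<open>The essential supremum of a nonmeasurable function is infinite, so measurability
    has to be shown; for \<phi> it follows from monotonicity.\<close>
  have "\<phi> \<in> borel_measurable lam"
    using borel_measurable_mono_on_fnc[OF \<phi>(2)]
    by (rule measurable_mono[THEN subsetD, rotated -1]) (auto simp: sets_restrict_space)
  then show "(\<lambda>t. ennreal (\<phi> t) * rearr (kernel_op k f) t) \<in> borel_measurable lam"
    by measurable
  show "AE t in lam. ennreal (\<phi> t) * rearr (kernel_op k f) t \<le> ennreal C * Linf_norm f"
  proof (rule AE_mp[OF le], intro AE_I2 impI)
    fix t assume "t \<in> space lam"
      and le: "rearr (kernel_op k f) t \<le> ennreal C * (\<integral>\<^sup>+ s. rearr f s \<partial>lebesgue_on {0<..<1 / \<phi> t})"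
    then have "0 < \<phi> t" using \<phi>(1) by simp
    have "(\<integral>\<^sup>+ s. rearr f s \<partial>lebesgue_on {0<..<1 / \<phi> t}) \<le> (\<integral>\<^sup>+ s. Linf_norm f \<partial>lebesgue_on {0<..<1 / \<phi> t})"
      by (intro nn_integral_mono rearr_le_Linf_norm f) auto
    also have "\<dots> = Linf_norm f * ennreal (1 / \<phi> t)"
      using \<open>0 < \<phi> t\<close> by (simp add: emeasure_restrict_space)
    finally have "rearr (kernel_op k f) t \<le> ennreal C * (Linf_norm f * ennreal (1 / \<phi> t))"
      using le by (meson mult_left_mono order_trans zero_le)
    then have "ennreal (\<phi> t) * rearr (kernel_op k f) t \<le> ennreal (\<phi> t) * (ennreal C * (Linf_norm f * ennreal (1 / \<phi> t)))"
      by (rule mult_left_mono) simp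
    also have "\<dots> = ennreal C * Linf_norm f * (ennreal (\<phi> t) * ennreal (1 / \<phi> t))"
      by (simp only: ac_simps)
    also have "ennreal (\<phi> t) * ennreal (1 / \<phi> t) = 1"
      using \<open>0 < \<phi> t\<close> by (simp flip: ennreal_mult)
    finally show "ennreal (\<phi> t) * rearr (kernel_op k f) t \<le> ennreal C * Linf_norm f"
      by simp
  qed
qed

section \<open>Testing the norm bounds on constants and intervals\<close>

lemma op_norm_le_D:
  assumes "op_norm N N' T \<le> c" "f \<in> fspace N" "N f \<le> 1"
  shows "N' (T f) \<le> c"
  using assms unfolding op_norm_def by (auto simp: SUP_le_iff)

text \<open>The test function is the constant 1, whose image is w; dividing by the positive weight
  \<phi>(t) isolates the rearrangement.\<close>

lemma rearr_kernel_one_le_of_op_norm: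
  assumes \<phi>: "\<And>t. 0 < t \<Longrightarrow> 0 < \<phi> t" and "0 < C"
    and le: "op_norm Linf_norm (m_norm \<phi>) (kernel_op k) \<le> ennreal C"
  shows "AE t in lam. rearr (\<lambda>t. enn2ereal (kernel_int k (\<lambda>_. 1) t)) t \<le> ennreal (C / \<phi> t)"
proof -
  have 1: "Linf_norm (\<lambda>_. enn2ereal 1) \<le> 1"
    unfolding Linf_norm_def by (intro esssup_I) auto
  then have "(\<lambda>_. enn2ereal 1) \<in> fspace Linf_norm"
    by (auto simp: fspace_def intro: le_less_trans)
  from op_norm_le_D[OF le this 1]
  have "m_norm \<phi> (\<lambda>t. enn2ereal (kernel_int k (\<lambda>_. 1) t)) \<le> ennreal C"
    by (simp add: kernel_op_of_enn[abs_def])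
  note norm_le = this
  have "AE t in lam. ennreal (\<phi> t) * rearr (\<lambda>t. enn2ereal (kernel_int k (\<lambda>_. 1) t)) t
      \<le> m_norm \<phi> (\<lambda>t. enn2ereal (kernel_int k (\<lambda>_. 1) t))"
    unfolding m_norm_def by (rule esssup_AE)
  then show ?thesis
  proof (rule AE_mp, intro AE_I2 impI)
    fix t let ?r = "rearr (\<lambda>t. enn2ereal (kernel_int k (\<lambda>_. 1) t)) t"
    assume "t \<in> space lam"
      "ennreal (\<phi> t) * ?r \<le> m_norm \<phi> (\<lambda>t. enn2ereal (kernel_int k (\<lambda>_. 1) t))"
    then have "0 < \<phi> t" and le: "ennreal (\<phi> t) * ?r \<le> ennreal C"
      using \<phi> norm_le by (auto intro: order_trans)
    have "?r = ennreal (1 / \<phi> t) * (ennreal (\<phi> t) * ?r)"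
      using \<open>0 < \<phi> t\<close> by (simp flip: mult.assoc ennreal_mult)
    also have "\<dots> \<le> ennreal (1 / \<phi> t) * ennreal C"
      using le by (rule mult_left_mono) simp
    also have "\<dots> = ennreal (C / \<phi> t)"
      using \<open>0 < \<phi> t\<close> \<open>0 < C\<close> by (simp flip: ennreal_mult)
    finally show "?r \<le> ennreal (C / \<phi> t)" .
  qed
qed

text \<open>The image of the indicator of (a,b) divided by b - a is the average of k(\<cdot>,t) over
  (a,b), so these averages are at most \<open>C\<close> for almost every \<open>t\<close>. Control
  over all rational intervals then bounds k(\<cdot>,t) itself.\<close>

lemma kernel_bounded_of_op_norm:
  assumes k: "admissible_kernel k" and "0 < C"
    and le: "op_norm L1_norm Linf_norm (kernel_op k) \<le> ennreal C"
  shows "AE t in lam. Linf_norm (\<lambda>s. enn2ereal (k s t)) \<le> ennreal C"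
proof -
  have interval: "AE t in lam. (\<integral>\<^sup>+ s. k s t * indicator {a<..<b} s \<partial>lam) \<le> ennreal (C * (b - a))"
    if ab: "0 \<le> a" "a < b" for a b
  proof -
    define g :: "real \<Rightarrow> ennreal" where "g s = ennreal (1 / (b - a)) * indicator {a<..<b} s" for s
    have I: "{a<..<b} \<in> sets lam"
      using ab by (auto simp: sets_restrict_space_iff)
    have g: "g \<in> borel_measurable lam"
      unfolding g_def[abs_def] using I by measurable
    have "L1_norm (\<lambda>s. enn2ereal (g s)) = ennreal (1 / (b - a)) * emeasure lam {a<..<b}"
      unfolding L1_norm_def using I by (simp add: g_def nn_integral_cmult_indicator)
    also have "emeasure lam {a<..<b} = ennreal (b - a)"
      using ab by (subst emeasure_restrict_space) auto
    also have "ennreal (1 / (b - a)) * ennreal (b - a) = 1"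
      using ab by (simp flip: ennreal_mult)
    finally have 1: "L1_norm (\<lambda>s. enn2ereal (g s)) = 1" .
    with g have "(\<lambda>s. enn2ereal (g s)) \<in> fspace L1_norm"
      by (simp add: fspace_def)
    from op_norm_le_D[OF le this] 1
    have "Linf_norm (\<lambda>t. enn2ereal (kernel_int k g t)) \<le> ennreal C"
      by (simp add: kernel_op_of_enn[abs_def])
    moreover have "AE t in lam. kernel_int k g t \<le> Linf_norm (\<lambda>t. enn2ereal (kernel_int k g t))"
      using esssup_AE[of "kernel_int k g" lam] by (simp add: Linf_norm_def)
    ultimately have "AE t in lam. kernel_int k g t \<le> ennreal C"
      by (auto elim!: eventually_mono)
    moreover have "AE t in lam. (\<lambda>s. k s t) \<in> borel_measurable lam"
      using k unfolding admissible_kernel_def by (auto elim: eventually_mono)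
    ultimately show ?thesis
    proof eventually_elim
      case (elim t)
      note [measurable] = elim(2)
      have "(\<integral>\<^sup>+ s. k s t * indicator {a<..<b} s \<partial>lam) =
          (\<integral>\<^sup>+ s. ennreal (b - a) * (g s * k s t) \<partial>lam)"
      proof (intro nn_integral_cong)
        fix s
        have "ennreal (b - a) * (g s * k s t) =
            ennreal (b - a) * ennreal (1 / (b - a)) * (k s t * indicator {a<..<b} s)"
          by (simp only: g_def ac_simps)
        also have "ennreal (b - a) * ennreal (1 / (b - a)) = 1"
          using ab by (simp flip: ennreal_mult)
        finally show "k s t * indicator {a<..<b} s = ennreal (b - a) * (g s * k s t)"
          by simp
      qed
      also have "\<dots> = ennreal (b - a) * kernel_int k g t"
        unfolding kernel_int_def using g elim(2) by (intro nn_integral_cmult borel_measurable_times_ennreal)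
      also have "\<dots> \<le> ennreal (b - a) * ennreal C"
        using elim(1) by (rule mult_left_mono) simp
      also have "\<dots> = ennreal (C * (b - a))"
        using ab \<open>0 < C\<close> by (simp add: mult.commute flip: ennreal_mult)
      finally show ?case .
    qed
  qed
  \<comment> \<open>The exceptional null set depends on the interval. Rational endpoints leave
    countably many, so a single null set of \<open>t\<close> works for all of them.\<close>
  have "AE t in lam. \<forall>a\<in>\<rat>. \<forall>b\<in>\<rat>. 0 \<le> a \<longrightarrow> a < b \<longrightarrow>
      (\<integral>\<^sup>+ s. k s t * indicator {a<..<b} s \<partial>lam) \<le> ennreal (C * (b - a))"
    using interval by (subst AE_ball_countable[OF countable_rat], intro ballI)+ simp
  moreover have "AE t in lam. (\<lambda>s. k s t) \<in> borel_measurable lam"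
    using k unfolding admissible_kernel_def by (auto elim: eventually_mono)
  ultimately show ?thesis
  proof eventually_elim
    case (elim t)
    have "AE s in lam. k s t \<le> ennreal C"
      using elim \<open>0 < C\<close> by (intro AE_le_of_rational_intervals) auto
    then show ?case
      using elim(2) by (auto simp: Linf_norm_def intro: esssup_I)
  qed
qed

theorem theorem3p9:
  fixes k :: "real \<Rightarrow> real \<Rightarrow> ennreal" and \<phi> :: "real \<Rightarrow> real" and C :: real
    and w :: "real \<Rightarrow> ereal"
  assumes "admissible_kernel k"
    and "\<And>t. 0 < t \<Longrightarrow> 0 < \<phi> t"
    and "mono_on {0<..} \<phi>"
    and "0 < C"
    and "\<And>t. 0 < t \<Longrightarrow> w t = enn2ereal (L1_norm (\<lambda>s. enn2ereal (k s t)))"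
  shows "let
      i = ((AE t in lam. rearr w t \<le> ennreal (C / \<phi> t)) \<and>
           (AE t in lam. Linf_norm (\<lambda>s. enn2ereal (k s t)) \<le> ennreal C));
      ii = (bounded_op (kernel_dom k) (kernel_op k) Linf_norm (m_norm \<phi>) \<and>
            bounded_op (kernel_dom k) (kernel_op k) L1_norm Linf_norm \<and>
            op_norm Linf_norm (m_norm \<phi>) (kernel_op k) \<le> ennreal C \<and>
            op_norm L1_norm Linf_norm (kernel_op k) \<le> ennreal C);
      iii = (\<forall>f \<in> L1_plus_Linf. f \<in> kernel_dom k \<and>
            (AE t in lam. rearr (kernel_op k f) t
               \<le> ennreal C * (\<integral>\<^sup>+ s. rearr f s \<partial>lebesgue_on {0<..<1 / \<phi> t})))
    in (i \<longleftrightarrow> ii) \<and> (ii \<longleftrightarrow> iii)"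
proof -
  note k = assms(1) and \<phi> = assms(2,3)
  define i where "i = ((AE t in lam. rearr w t \<le> ennreal (C / \<phi> t)) \<and>
    (AE t in lam. Linf_norm (\<lambda>s. enn2ereal (k s t)) \<le> ennreal C))"
  define ii where "ii = (bounded_op (kernel_dom k) (kernel_op k) Linf_norm (m_norm \<phi>) \<and>
    bounded_op (kernel_dom k) (kernel_op k) L1_norm Linf_norm \<and>
    op_norm Linf_norm (m_norm \<phi>) (kernel_op k) \<le> ennreal C \<and>
    op_norm L1_norm Linf_norm (kernel_op k) \<le> ennreal C)"
  define iii where "iii = (\<forall>f \<in> L1_plus_Linf. f \<in> kernel_dom k \<and>
    (AE t in lam. rearr (kernel_op k f) t
      \<le> ennreal C * (\<integral>\<^sup>+ s. rearr f s \<partial>lebesgue_on {0<..<1 / \<phi> t})))"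
  \<comment> \<open>\<open>w\<close> is prescribed only on the positive half-line, which is all that
    \<open>rearr\<close> sees.\<close>
  have w: "rearr w = rearr (\<lambda>t. enn2ereal (kernel_int k (\<lambda>_. 1) t))"
    using assms(5) by (intro rearr_cong_on) (simp add: L1_norm_def kernel_int_def)
  have "iii" if i
    unfolding iii_def
  proof (intro ballI conjI)
    from that have le: "AE t in lam. Linf_norm (\<lambda>s. enn2ereal (k s t)) \<le> ennreal C"
      and rw: "AE t in lam. rearr w t \<le> ennreal (C / \<phi> t)"
      by (auto simp: i_def)
    fix f assume f: "f \<in> L1_plus_Linf"
    then show "f \<in> kernel_dom k"
      using L1_plus_Linf_subset_kernel_dom[OF k le] by blast
    have "f \<in> meas_fun" using f by (simp add: L1_plus_Linf_def)
    show "AE t in lam. rearr (kernel_op k f) t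
        \<le> ennreal C * (\<integral>\<^sup>+ s. rearr f s \<partial>lebesgue_on {0<..<1 / \<phi> t})"
    proof (rule AE_mp[OF rw], intro AE_I2 impI)
      fix t assume "t \<in> space lam" "rearr w t \<le> ennreal (C / \<phi> t)"
      \<comment> \<open>Take \<open>a = 1 / \<phi> t\<close>, so that \<open>C / \<phi> t\<close> is
        \<open>C * a\<close>.\<close>
      then show "rearr (kernel_op k f) t \<le> ennreal C * (\<integral>\<^sup>+ s. rearr f s \<partial>lebesgue_on {0<..<1 / \<phi> t})"
        using \<open>f \<in> meas_fun\<close> \<open>0 < C\<close> \<phi>(1)[of t] le w
        by (intro rearr_kernel_op_le k) auto
    qed
  qed
  moreover have ii if iii
  proof -
    note iii = that[unfolded iii_def, rule_format]
    have meas: "kernel_op k f \<in> meas_fun" if "f \<in> L1_plus_Linf" for f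
      using that by (intro kernel_op_measurable[OF k]) (simp add: L1_plus_Linf_def)
    have "bounded_op (kernel_dom k) (kernel_op k) Linf_norm (m_norm \<phi>) \<and>
        op_norm Linf_norm (m_norm \<phi>) (kernel_op k) \<le> ennreal C"
    proof (rule bounded_opI)
      fix f assume "f \<in> fspace Linf_norm"
      moreover from this have "f \<in> L1_plus_Linf" using fspace_subset_L1_plus_Linf by blast
      ultimately show "kernel_op k f \<in> meas_fun" "m_norm \<phi> (kernel_op k f) \<le> ennreal C * Linf_norm f"
        using iii meas \<phi> by (auto intro!: m_norm_kernel_op_le k)
    qed (use iii fspace_subset_L1_plus_Linf in blast)
    moreover have "bounded_op (kernel_dom k) (kernel_op k) L1_norm Linf_norm \<and>
        op_norm L1_norm Linf_norm (kernel_op k) \<le> ennreal C"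
    proof (rule bounded_opI)
      fix f assume f: "f \<in> fspace L1_norm"
      then have f': "f \<in> L1_plus_Linf" using fspace_subset_L1_plus_Linf by blast
      show "kernel_op k f \<in> meas_fun" using meas[OF f'] .
      show "Linf_norm (kernel_op k f) \<le> ennreal C * L1_norm f"
      proof (rule Linf_norm_le_of_rearr_le[OF meas[OF f']])
        show "AE t in lam. rearr (kernel_op k f) t \<le> ennreal C * L1_norm f"
        proof (rule AE_mp[OF iii[OF f', THEN conjunct2]], intro AE_I2 impI)
          fix t assume "t \<in> space lam"
            and le: "rearr (kernel_op k f) t \<le> ennreal C * (\<integral>\<^sup>+ s. rearr f s \<partial>lebesgue_on {0<..<1 / \<phi> t})"
          \<comment> \<open>This bound does not depend on the upper limit, so \<phi> disappears from
            the estimate.\<close>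
          then have "(\<integral>\<^sup>+ s. rearr f s \<partial>lebesgue_on {0<..<1 / \<phi> t}) \<le> L1_norm f"
            using f \<phi>(1)[of t] by (intro nn_integral_rearr_le_L1_norm) (auto simp: fspace_def less_imp_le)
          with le show "rearr (kernel_op k f) t \<le> ennreal C * L1_norm f"
            by (meson mult_left_mono order_trans zero_le)
        qed
      qed
    qed (use iii fspace_subset_L1_plus_Linf in blast)
    ultimately show ?thesis unfolding ii_def by blast
  qed
  moreover have i if ii
    unfolding i_def w
  proof
    show "AE t in lam. rearr (\<lambda>t. enn2ereal (kernel_int k (\<lambda>_. 1) t)) t \<le> ennreal (C / \<phi> t)"
      using that \<phi>(1) \<open>0 < C\<close> by (intro rearr_kernel_one_le_of_op_norm) (auto simp: ii_def)
    show "AE t in lam. Linf_norm (\<lambda>s. enn2ereal (k s t)) \<le> ennreal C"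
      using that by (intro kernel_bounded_of_op_norm[OF k \<open>0 < C\<close>]) (simp add: ii_def)
  qed
  ultimately show ?thesis
    unfolding i_def ii_def iii_def Let_def by blast
qed

end
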